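(* Let $\ell\in[0,2]$. Then every $\ell$-rapidly oscillating solution of $x'(t)+c(t)x(\tau(t))=0$ is bounded. Moreover, if $\ell\in[0,2)$, then every $\ell$-rapidly oscillating solution tends to zero as $t\to\infty$.
   Context: Consider the equation $x'(t)+c(t)x(\tau(t))=0$, $t\ge 0$. Standing assumptions: $c:[0,\infty)\to\mathbb R$ (of arbitrary, possibly changing, sign) is Lebesgue measurable and locally integrable ($\int_0^t|c(u)|du<\infty$ for all $t\ge0$); $\tau:[0,\infty)\to\mathbb R$ is Lebesgue measurable, $\tau(t)\le t$ for all $t\ge 0$, and $\lim_{t\to\infty}\tau(t)=\infty$. For $t\ge0$ put $\tau_{\min}(t):=\inf_{v\ge t}\tau(v)$. Fix $a\ge 0$ with $\tau_{\min}(a)>0$ (such $a$ exists), and fix a number $\rho>\inf\{t>0:\tau_{\min}(t)>a\}$. A solution of the equation is a function $x:[\tau_{\min}(t_0),\infty)\to\mathbb R$, for some $t_0\in[\rho,\infty)$, which is absolutely continuous on $[\tau_{\min}(t_0),\infty)$ (i.e. on each compact subinterval) and satisfies the equation for almost every $t\in[t_0,\infty)$. For $\ell\in[0,\infty)$, a function $x$ defined (at least) on $[t_0,\infty)$ is called $\ell$-rapidly oscillating if it has arbitrarily large zeros and there is $t_1\ge t_0$ such that for all $A,B\in[t_1,\infty)$ with $A<B$: if $x(v)\ne0$ for all $v\in(A,B)$, then $\int_A^B|c(v)|\,dv\le\ell$. *)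

theory Defs
  imports "HOL-Analysis.Analysis"
begin

text \<open>
  Functions on a half-line are total functions on the reals; every condition below refers only
  to arguments in the mathematical domain (\<open>{0..}\<close> for \<open>c\<close> and \<open>\<tau>\<close>, \<open>sol_domain \<tau> t0\<close> for a solution
  with initial point \<open>t0\<close>).
\<close>

definition abs_continuous_on :: "(real \<Rightarrow> real) \<Rightarrow> real set \<Rightarrow> bool" where
  "abs_continuous_on f S \<longleftrightarrow>
     (\<forall>\<epsilon>>0. \<exists>\<delta>>0. \<forall>d T. d division_of T \<and> T \<subseteq> S \<and> (\<Sum>k\<in>d. Sup k - Inf k) < \<delta>
        \<longrightarrow> (\<Sum>k\<in>d. \<bar>f (Sup k) - f (Inf k)\<bar>) < \<epsilon>)"

text \<open>
  The members of a division are compact intervals \<open>k = {Inf k..Sup k}\<close> with pairwise disjoint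
  interiors, so this is the usual definition in terms of finite families of nonoverlapping intervals.
\<close>

definition locally_abs_continuous_on :: "(real \<Rightarrow> real) \<Rightarrow> real set \<Rightarrow> bool" where
  "locally_abs_continuous_on f S \<longleftrightarrow>
     (\<forall>p q. p \<le> q \<and> {p..q} \<subseteq> S \<longrightarrow> abs_continuous_on f {p..q})"

definition dde_data :: "(real \<Rightarrow> real) \<Rightarrow> (real \<Rightarrow> real) \<Rightarrow> bool" where
  "dde_data c \<tau> \<longleftrightarrow>
     c \<in> borel_measurable (lebesgue_on {0..}) \<and>
     (\<forall>t\<ge>0. c absolutely_integrable_on {0..t}) \<and>
     \<tau> \<in> borel_measurable (lebesgue_on {0..}) \<and>
     (\<forall>t\<ge>0. \<tau> t \<le> t) \<and>
     filterlim \<tau> at_top at_top"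

text \<open>
  The infimum is taken in the extended reals, because \<open>\<tau>\<close> need not be bounded below on bounded
  intervals (the infimum over an unbounded set of reals would be an unspecified real number).
\<close>

definition tau_min :: "(real \<Rightarrow> real) \<Rightarrow> real \<Rightarrow> ereal" where
  "tau_min \<tau> t = (INF v\<in>{t..}. ereal (\<tau> v))"

definition sol_domain :: "(real \<Rightarrow> real) \<Rightarrow> real \<Rightarrow> real set" where
  "sol_domain \<tau> t0 = {s. tau_min \<tau> t0 \<le> ereal s}"

definition dde_solution ::
  "(real \<Rightarrow> real) \<Rightarrow> (real \<Rightarrow> real) \<Rightarrow> real \<Rightarrow> (real \<Rightarrow> real) \<Rightarrow> bool" where
  "dde_solution c \<tau> t0 x \<longleftrightarrow>
     locally_abs_continuous_on x (sol_domain \<tau> t0) \<and>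
     (AE t in lebesgue. t \<ge> t0 \<longrightarrow>
        (\<exists>D. (x has_real_derivative D) (at t within sol_domain \<tau> t0) \<and> D + c t * x (\<tau> t) = 0))"

definition rapidly_oscillating ::
  "(real \<Rightarrow> real) \<Rightarrow> real \<Rightarrow> real \<Rightarrow> (real \<Rightarrow> real) \<Rightarrow> bool" where
  "rapidly_oscillating c l t0 x \<longleftrightarrow>
     (\<forall>T. \<exists>t\<ge>T. t \<ge> t0 \<and> x t = 0) \<and>
     (\<exists>t1\<ge>t0. \<forall>A\<ge>t1. \<forall>B\<ge>t1. A < B \<and> (\<forall>v\<in>{A<..<B}. x v \<noteq> 0)
        \<longrightarrow> (LINT v:{A..B}|lebesgue. \<bar>c v\<bar>) \<le> l)"

end

theory Submission
  imports Defs
begin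

text \<open>
  On a nodal interval \<open>(A,B)\<close> of \<open>x\<close>, integrating the equation from \<open>A\<close> to \<open>s\<close> and from \<open>s\<close> to \<open>B\<close>
  gives \<open>2\<bar>x s\<bar> \<le> K \<integral>\<^sub>A\<^sup>B\<bar>c\<bar> \<le> K l\<close> whenever \<open>K\<close> bounds \<open>\<bar>x \<circ> \<tau>\<bar>\<close> there. For \<open>l < 2\<close> this contracts
  eventual bounds of \<open>\<bar>x\<bar>\<close> by the factor \<open>l/2\<close>. For boundedness with \<open>l = 2\<close>, take \<open>s\<close> to be the first
  point at which \<open>\<bar>x\<bar>\<close> attains a new maximum \<open>K\<close>: as \<open>\<tau> v \<le> v\<close>, the bound \<open>K\<close> can be improved before
  \<open>s\<close>, so the inequality becomes strict and yields the contradiction \<open>2 K < 2 K\<close>.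
\<close>

section \<open>Absolute continuity and the fundamental theorem of calculus\<close>

lemma abs_continuous_on_imp_continuous_on:
  assumes "abs_continuous_on f {a..b}"
  shows "continuous_on {a..b} f"
  unfolding continuous_on_iff
proof (intro ballI allI impI)
  fix s e :: real
  assume s: "s \<in> {a..b}" and e: "e > 0"
  obtain \<delta> where "\<delta> > 0" and \<delta>: "\<And>d T. d division_of T \<Longrightarrow> T \<subseteq> {a..b} \<Longrightarrow> (\<Sum>k\<in>d. Sup k - Inf k) < \<delta>
      \<Longrightarrow> (\<Sum>k\<in>d. \<bar>f (Sup k) - f (Inf k)\<bar>) < e"
    using assms e unfolding abs_continuous_on_def by meson
  \<comment> \<open>A division with the single member \<open>{p..q}\<close> turns the definition
    into uniform continuity.\<close>
  have *: "\<bar>f q - f p\<bar> < e" if "p \<le> q" "a \<le> p" "q \<le> b" "q - p < \<delta>" for p q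
    using \<delta>[of "{{p..q}}" "{p..q}"] that division_of_self[of p q] by (simp add: cbox_interval)
  have "dist (f t) (f s) < e" if "t \<in> {a..b}" "dist t s < \<delta>" for t
    using *[of s t] *[of t s] that s by (cases "s \<le> t") (auto simp: dist_real_def)
  then show "\<exists>d>0. \<forall>t\<in>{a..b}. dist t s < d \<longrightarrow> dist (f t) (f s) < e"
    using \<open>\<delta> > 0\<close> by blast
qed

text \<open>
  The exceptional set is handled by a gauge that confines the intervals tagged there to an open
  set of small measure, on which absolute continuity bounds the increments of \<open>f\<close>.
\<close>

lemma fundamental_theorem_of_calculus_abs_continuous:
  fixes f g :: "real \<Rightarrow> real"
  assumes ac: "abs_continuous_on f {a..b}" and "a \<le> b" and N: "negligible N"
    and der: "\<And>t. t \<in> {a..b} - N \<Longrightarrow> (f has_real_derivative g t) (at t within {a..b})"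
  shows "(g has_integral (f b - f a)) {a..b}"
proof -
  \<comment> \<open>Setting the integrand to 0 on \<open>N\<close> leaves only increments of
    \<open>f\<close> to be estimated for the intervals tagged there; a spike argument restores
    \<open>g\<close> at the end.\<close>
  define h where "h t = (if t \<in> N then 0 else g t)" for t
  have "(h has_integral (f b - f a)) {a..b}"
    unfolding has_integral_real
  proof (intro allI impI)
    fix e :: real
    assume e: "e > 0"
    \<comment> \<open>The summand 1 keeps the denominator positive when \<open>a = b\<close> and
      makes the bound on \<open>e' * (b - a)\<close> strict.\<close>
    define e' where "e' = e / (2 * (b - a + 1))"
    have e': "e' > 0" "e' * (b - a) < e / 2"
      using e \<open>a \<le> b\<close> by (auto simp: e'_def field_simps)
    obtain \<delta> where "\<delta> > 0" and \<delta>: "\<And>d T. d division_of T \<Longrightarrow> T \<subseteq> {a..b} \<Longrightarrow> (\<Sum>k\<in>d. Sup k - Inf k) < \<delta>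
        \<Longrightarrow> (\<Sum>k\<in>d. \<bar>f (Sup k) - f (Inf k)\<bar>) < e / 2"
      using ac e unfolding abs_continuous_on_def by (meson half_gt_zero)
    obtain U where U: "open U" "N \<subseteq> U" "U - N \<in> lmeasurable" "emeasure lebesgue (U - N) < ennreal \<delta>"
      using sets_lebesgue_outer_open[of N \<delta>] N \<open>\<delta> > 0\<close> negligible_imp_sets by blast
    have U_meas: "U \<in> lmeasurable" "measure lebesgue U < \<delta>"
    proof -
      have UN: "U = (U - N) \<union> N"
        using U by blast
      show "U \<in> lmeasurable"
        using UN U(3) N by (metis fmeasurable.Un negligible_imp_measurable)
      have "measure lebesgue U \<le> measure lebesgue (U - N) + measure lebesgue N"
        using UN U(3) N measure_Un_le[of "U - N" lebesgue N] by (metis fmeasurableD negligible_imp_sets)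
      also have "\<dots> < \<delta>"
        using U(3,4) N \<open>\<delta> > 0\<close> by (simp add: negligible_imp_measure0 emeasure_eq_measure2 ennreal_less_iff)
      finally show "measure lebesgue U < \<delta>" .
    qed
    \<comment> \<open>Tags in \<open>N\<close> get a ball inside \<open>U\<close>; tags in
      \<open>{a..b} - N\<close> get a ball on which differentiability bounds the linearisation error
      with slope \<open>e'\<close>.\<close>
    have "\<exists>r>0. (t \<in> N \<longrightarrow> ball t r \<subseteq> U) \<and>
        (t \<in> {a..b} - N \<longrightarrow> (\<forall>y\<in>{a..b}. \<bar>y - t\<bar> < r \<longrightarrow> \<bar>f y - f t - g t * (y - t)\<bar> \<le> e' * \<bar>y - t\<bar>))" for t
    proof (cases "t \<in> N")
      case True
      then show ?thesis
        using U(1,2) by (meson DiffD2 open_contains_ball subsetD)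
    next
      case False
      show ?thesis
      proof (cases "t \<in> {a..b}")
        case True
        then show ?thesis
          using False der[of t] e'(1) unfolding has_field_derivative_def has_derivative_within_alt
          by (auto simp: real_norm_def)
      qed (use False in \<open>auto intro: exI[of _ 1]\<close>)
    qed
    then obtain r where r: "\<And>t. r t > 0" "\<And>t. t \<in> N \<Longrightarrow> ball t (r t) \<subseteq> U"
      "\<And>t y. t \<in> {a..b} - N \<Longrightarrow> y \<in> {a..b} \<Longrightarrow> \<bar>y - t\<bar> < r t
        \<Longrightarrow> \<bar>f y - f t - g t * (y - t)\<bar> \<le> e' * \<bar>y - t\<bar>"
      by metis
    show "\<exists>\<gamma>. gauge \<gamma> \<and> (\<forall>\<D>. \<D> tagged_division_of {a..b} \<and> \<gamma> fine \<D> \<longrightarrow>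
        norm ((\<Sum>(x, k)\<in>\<D>. measure lborel k *\<^sub>R h x) - (f b - f a)) < e)"
    proof (intro exI[of _ "\<lambda>t. ball t (r t)"] conjI allI impI)
      show "gauge (\<lambda>t. ball t (r t))"
        using r(1) by (simp add: gauge_ball_dependent)
      fix \<D>
      assume "\<D> tagged_division_of {a..b} \<and> (\<lambda>t. ball t (r t)) fine \<D>"
      then have \<D>: "\<D> tagged_division_of {a..b}" and fine: "\<And>t k. (t, k) \<in> \<D> \<Longrightarrow> k \<subseteq> ball t (r t)"
        by (auto simp: fine_def)
      have fin: "finite \<D>"
        using \<D> by blast
      have ivl: "\<exists>u v. k = {u..v} \<and> u \<le> t \<and> t \<le> v \<and> a \<le> u \<and> v \<le> b" if tk: "(t, k) \<in> \<D>" for t k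
      proof -
        obtain u v where uv: "k = {u..v}"
          using tagged_division_ofD(4)[OF \<D> tk] by (auto simp: cbox_interval)
        then show ?thesis
          using tagged_division_ofD(2,3)[OF \<D> tk] by auto
      qed
      define E where "E = (\<lambda>(t, k). measure lborel k * h t - (f (Sup k) - f (Inf k)))"
      define P where "P = {p \<in> \<D>. fst p \<in> N}"
      have "(\<Sum>(t, k)\<in>\<D>. measure lborel k *\<^sub>R h t) - (f b - f a) = (\<Sum>p\<in>\<D>. E p)"
        using additive_tagged_division_1[OF \<open>a \<le> b\<close> \<D>, of f]
        by (simp add: E_def sum_subtractf case_prod_unfold)
      also have "\<dots> = (\<Sum>p\<in>P. E p) + (\<Sum>p\<in>\<D> - P. E p)"
        using sum.subset_diff[of P \<D> E] fin by (simp add: P_def add.commute)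
      finally have split: "(\<Sum>(t, k)\<in>\<D>. measure lborel k *\<^sub>R h t) - (f b - f a) = (\<Sum>p\<in>P. E p) + (\<Sum>p\<in>\<D> - P. E p)" .
      have good: "\<bar>\<Sum>p\<in>\<D> - P. E p\<bar> < e / 2"
      proof -
        have "\<bar>E p\<bar> \<le> e' * measure lborel (snd p)" if p: "p \<in> \<D> - P" for p
        proof -
          obtain t k where tk: "p = (t, k)" "(t, k) \<in> \<D>" "t \<notin> N"
            using p by (cases p) (auto simp: P_def)
          obtain u v where uv: "k = {u..v}" "u \<le> t" "t \<le> v" "a \<le> u" "v \<le> b"
            using ivl[OF tk(2)] by blast
          have "{u, v} \<subseteq> k"
            using uv by auto
          then have "u \<in> ball t (r t)" "v \<in> ball t (r t)"
            using fine[OF tk(2)] by auto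
          then have "\<bar>f u - f t - g t * (u - t)\<bar> \<le> e' * \<bar>u - t\<bar>" "\<bar>f v - f t - g t * (v - t)\<bar> \<le> e' * \<bar>v - t\<bar>"
            using uv tk(3) by (intro r(3); simp add: dist_real_def)+
          \<comment> \<open>As \<open>u \<le> t \<le> v\<close>, the error bounds at the two
            endpoints add up to exactly \<open>e' * (v - u)\<close>.\<close>
          then have "\<bar>(v - u) * g t - (f v - f u)\<bar> \<le> e' * (v - u)"
            using uv(2,3) by (simp add: algebra_simps)
          then show ?thesis
            using uv tk(3) by (simp add: tk(1) E_def h_def)
        qed
        then have "\<bar>\<Sum>p\<in>\<D> - P. E p\<bar> \<le> (\<Sum>p\<in>\<D> - P. e' * measure lborel (snd p))"
          by (intro order_trans[OF sum_abs sum_mono])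
        also have "\<dots> \<le> (\<Sum>p\<in>\<D>. e' * measure lborel (snd p))"
          using fin e'(1) by (intro sum_mono2) auto
        also have "\<dots> = e' * (b - a)"
          using additive_content_tagged_division[of \<D> a b] \<D> \<open>a \<le> b\<close>
          by (simp add: cbox_interval sum_distrib_left[symmetric] case_prod_unfold)
        finally show ?thesis
          using e'(2) by linarith
      qed
      have bad: "\<bar>\<Sum>p\<in>P. E p\<bar> < e / 2"
      proof -
        have "P tagged_partial_division_of {a..b}"
          using \<D> tagged_partial_division_subset[of \<D> "{a..b}" P] by (auto simp: tagged_division_of_def P_def)
        then have P: "P tagged_division_of (\<Union>(snd ` P))"
          by (rule tagged_partial_division_of_Union_self)
        note div = division_of_tagged_division[OF P]
        have ivl': "\<exists>u v. k = {u..v} \<and> u \<le> v \<and> {u..v} \<subseteq> {a..b} \<inter> U" if k: "k \<in> snd ` P" for k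
        proof -
          obtain t where t: "(t, k) \<in> \<D>" "t \<in> N"
            using k by (auto simp: P_def)
          then have "k \<subseteq> U"
            using fine[OF t(1)] r(2)[OF t(2)] by blast
          then show ?thesis
            using ivl[OF t(1)] by fastforce
        qed
        \<comment> \<open>The intervals tagged in \<open>N\<close> lie in \<open>U\<close>, so their
          total length is below \<open>\<delta>\<close> and absolute continuity applies.\<close>
        have "(\<Sum>k\<in>snd ` P. Sup k - Inf k) = (\<Sum>k\<in>snd ` P. measure lebesgue k)"
          using ivl' by (intro sum.cong) fastforce+
        also have "\<dots> = measure lebesgue (\<Union>(snd ` P))"
          using div by (rule content_division)
        also have "\<dots> \<le> measure lebesgue U"
          using ivl' lmeasurable_division[OF div] U_meas(1) by (intro measure_mono_fmeasurable) fastforce+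
        finally have small: "(\<Sum>k\<in>snd ` P. \<bar>f (Sup k) - f (Inf k)\<bar>) < e / 2"
          using ivl' U_meas(2) by (intro \<delta>[OF div]) fastforce+
        \<comment> \<open>Passing from tagged pairs to intervals calls for a summand that vanishes
          on every box with empty interior; on \<open>{}\<close>, where \<open>Sup\<close> and
          \<open>Inf\<close> are unspecified, this has to be stipulated.\<close>
        define F where "F k = (if k = {} then 0 else \<bar>f (Sup k) - f (Inf k)\<bar>)" for k :: "real set"
        have nonempty: "k \<noteq> {}" if "k \<in> snd ` P" for k
          using ivl'[OF that] by auto
        have "\<bar>\<Sum>p\<in>P. E p\<bar> \<le> (\<Sum>p\<in>P. \<bar>E p\<bar>)"
          by (rule sum_abs)
        also have "\<dots> = (\<Sum>(t, k)\<in>P. F k)"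
          using nonempty by (intro sum.cong) (force simp: E_def F_def h_def P_def)+
        also have "\<dots> = (\<Sum>k\<in>snd ` P. F k)"
        proof (rule sum.over_tagged_division_lemma[OF P])
          fix u v :: real
          assume "box u v = {}"
          then show "F (cbox u v) = 0"
            by (cases "u = v") (auto simp: F_def cbox_interval box_real)
        qed
        also have "\<dots> = (\<Sum>k\<in>snd ` P. \<bar>f (Sup k) - f (Inf k)\<bar>)"
          using nonempty by (intro sum.cong) (auto simp: F_def)
        finally show ?thesis
          using small by linarith
      qed
      show "norm ((\<Sum>(t, k)\<in>\<D>. measure lborel k *\<^sub>R h t) - (f b - f a)) < e"
        unfolding split using good bad by simp
    qed
  qed
  then show ?thesis
    by (rule has_integral_spike[OF N, rotated]) (simp add: h_def)
qed

section \<open>Nodal intervals of a continuous function\<close>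

text \<open>The endpoints are the last zero before \<open>s\<close> and the first zero after it;
  both exist because the zeros in \<open>{T..Z}\<close> form a closed set containing
  \<open>T\<close> and \<open>Z\<close>.\<close>

lemma nodal_interval:
  fixes x :: "real \<Rightarrow> real"
  assumes cont: "continuous_on {T..Z} x" and "x T = 0" "x Z = 0" "T \<le> s" "s \<le> Z" "x s \<noteq> 0"
  obtains A B where "T \<le> A" "A < s" "s < B" "B \<le> Z" "x A = 0" "x B = 0" "\<And>v. v \<in> {A<..<B} \<Longrightarrow> x v \<noteq> 0"
proof -
  define L where "L = {T..s} \<inter> x -` {0}"
  define R where "R = {s..Z} \<inter> x -` {0}"
  have "continuous_on {T..s} x" "continuous_on {s..Z} x"
    using assms by (auto intro: continuous_on_subset[OF cont])
  then have "closed L" "closed R"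
    unfolding L_def R_def by (auto intro: continuous_closed_preimage)
  moreover have L: "T \<in> L" "bdd_above L" and R: "Z \<in> R" "bdd_below R"
    using assms by (auto simp: L_def R_def bdd_above_def bdd_below_def)
  ultimately have SL: "Sup L \<in> L" and IR: "Inf R \<in> R"
    by (auto intro: closed_contains_Sup closed_contains_Inf)
  show thesis
  proof (rule that[of "Sup L" "Inf R"])
    show "T \<le> Sup L" "Inf R \<le> Z" "x (Sup L) = 0" "x (Inf R) = 0"
      using SL IR by (auto simp: L_def R_def)
    show "Sup L < s" "s < Inf R"
      using SL IR \<open>x s \<noteq> 0\<close> by (auto simp: L_def R_def less_le)
    show "x v \<noteq> 0" if v: "v \<in> {Sup L<..<Inf R}" for v
    proof
      assume "x v = 0"
      then have "v \<in> L \<or> v \<in> R"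
        using v SL IR by (auto simp: L_def R_def)
      then show False
        using v cSup_upper[OF _ L(2), of v] cInf_lower[OF _ R(2), of v] by auto
    qed
  qed
qed

section \<open>Solutions on a closed half-line and their increments\<close>

text \<open>A finite value of \<open>tau_min \<tau> t0\<close> makes the solution domain the
  half-line \<open>{m..}\<close>; fixing the real number \<open>m\<close> keeps extended reals out
  of the estimates.\<close>

locale dde_solution_on =
  fixes c \<tau> x :: "real \<Rightarrow> real" and t0 m :: real
  assumes data: "dde_data c \<tau>" and sol: "dde_solution c \<tau> t0 x"
    and t0_nonneg: "0 \<le> t0" and tau_min_t0: "tau_min \<tau> t0 = ereal m"
begin

lemma domain_eq: "sol_domain \<tau> t0 = {m..}"
  by (auto simp: sol_domain_def tau_min_t0)

lemma delay_ge: "m \<le> \<tau> v" if "t0 \<le> v"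
proof -
  have "tau_min \<tau> t0 \<le> ereal (\<tau> v)"
    unfolding tau_min_def using that by (intro INF_lower) auto
  then show ?thesis
    by (simp add: tau_min_t0)
qed

lemma delay_le: "\<tau> v \<le> v" if "t0 \<le> v"
  using data that t0_nonneg by (auto simp: dde_data_def)

lemma m_le_t0: "m \<le> t0"
  using delay_ge[of t0] delay_le[of t0] by linarith

lemma abs_continuous: "abs_continuous_on x {p..q}" if "m \<le> p" "p \<le> q"
  using sol that unfolding dde_solution_def locally_abs_continuous_on_def domain_eq
  by (metis Icc_subset_Ici_iff)

lemma continuous: "continuous_on {p..q} x" if "m \<le> p"
  using abs_continuous[OF that] by (cases "p \<le> q") (auto intro: abs_continuous_on_imp_continuous_on)

text \<open>A gauge integral, so that additivity and norm bounds apply directly; \<open>V_eq\<close>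
  identifies it with the Lebesgue integral of the oscillation condition.\<close>

definition V where "V p q = integral {p..q} (\<lambda>v. \<bar>c v\<bar>)"

lemma abs_c_integrable: "c absolutely_integrable_on {p..q}" if "t0 \<le> p"
  using data that t0_nonneg unfolding dde_data_def
  by (cases "p \<le> q") (auto intro: set_integrable_subset[of lebesgue "{0..q}"])

lemma V_eq: "(LINT v:{p..q}|lebesgue. \<bar>c v\<bar>) = V p q" if "t0 \<le> p"
  unfolding V_def using abs_c_integrable[OF that, of q]
  by (intro set_lebesgue_integral_eq_integral) (rule set_integrable_abs)

lemma V_nonneg: "0 \<le> V p q"
  \<comment> \<open>The integral of a non-integrable function is 0 by convention, which settles the
    second case.\<close>
  unfolding V_def by (cases "(\<lambda>v. \<bar>c v\<bar>) integrable_on {p..q}") (auto intro: integral_nonneg simp: not_integrable_integral)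

lemma V_combine: "V p r = V p q + V q r" if "t0 \<le> p" "p \<le> q" "q \<le> r"
proof -
  have "(\<lambda>v. \<bar>c v\<bar>) integrable_on {p..r}"
    using abs_c_integrable[of p r] that by (auto simp: absolutely_integrable_on_def)
  then show ?thesis
    unfolding V_def using that Henstock_Kurzweil_Integration.integral_combine[of p q r "\<lambda>v. \<bar>c v\<bar>"] by simp
qed

text \<open>The equation is integrated over \<open>{p..q}\<close>. Integrability of
  \<open>c t * x (\<tau> t)\<close> comes out of the fundamental theorem of calculus rather than
  from a measurability argument.\<close>

lemma increment_le:
  assumes "t0 \<le> p" "p \<le> q" and K: "\<And>v. v \<in> {p..q} \<Longrightarrow> \<bar>x (\<tau> v)\<bar> \<le> K"
  shows "\<bar>x q - x p\<bar> \<le> K * V p q"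
proof -
  have "AE t in lebesgue. t \<ge> t0 \<longrightarrow> (\<exists>D. (x has_real_derivative D) (at t within {m..}) \<and> D + c t * x (\<tau> t) = 0)"
    using sol by (simp add: dde_solution_def domain_eq)
  then obtain N where N: "negligible N"
    and der: "\<And>t. t \<notin> N \<Longrightarrow> t \<ge> t0 \<Longrightarrow> \<exists>D. (x has_real_derivative D) (at t within {m..}) \<and> D + c t * x (\<tau> t) = 0"
    unfolding eventually_ae_filter_negligible by blast
  have "((\<lambda>t. - (c t * x (\<tau> t))) has_integral (x q - x p)) {p..q}"
  proof (rule fundamental_theorem_of_calculus_abs_continuous[OF _ \<open>p \<le> q\<close> N])
    show "abs_continuous_on x {p..q}"
      using assms m_le_t0 by (intro abs_continuous) auto
    show "(x has_real_derivative - (c t * x (\<tau> t))) (at t within {p..q})" if t: "t \<in> {p..q} - N" for t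
    proof -
      obtain D where D: "(x has_real_derivative D) (at t within {m..})" "D + c t * x (\<tau> t) = 0"
        using der[of t] t assms by auto
      moreover have "D = - (c t * x (\<tau> t))"
        using D(2) by linarith
      ultimately show ?thesis
        using assms m_le_t0 by (auto intro: DERIV_subset)
    qed
  qed
  then have "norm (x q - x p) \<le> integral {p..q} (\<lambda>v. K * \<bar>c v\<bar>)"
  proof (subst integral_unique[symmetric], assumption, intro integral_norm_bound_integral)
    show "(\<lambda>v. K * \<bar>c v\<bar>) integrable_on {p..q}"
      using abs_c_integrable[of p q] assms(1) by (auto simp: absolutely_integrable_on_def intro: integrable_on_mult_right)
    show "norm (- (c v * x (\<tau> v))) \<le> K * \<bar>c v\<bar>" if "v \<in> {p..q}" for v
      using mult_right_mono[OF K[OF that], of "\<bar>c v\<bar>"] by (simp add: abs_mult mult.commute)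
  qed blast
  then show ?thesis
    by (simp add: V_def)
qed

text \<open>Since \<open>x\<close> vanishes at both ends, \<open>\<bar>x s\<bar>\<close> equals the
  size of the increment on \<open>{A..s}\<close> and of the one on \<open>{s..B}\<close>; adding the
  two gives the factor 2.\<close>

lemma nodal_bound:
  assumes "t0 \<le> A" "A \<le> s" "s \<le> B" "x A = 0" "x B = 0" and K: "\<And>v. v \<in> {A..B} \<Longrightarrow> \<bar>x (\<tau> v)\<bar> \<le> K"
  shows "2 * \<bar>x s\<bar> \<le> K * V A B"
proof -
  have "\<bar>x s - x A\<bar> \<le> K * V A s" "\<bar>x B - x s\<bar> \<le> K * V s B"
    using assms by (intro increment_le; simp)+
  then show ?thesis
    using V_combine[of A s B] assms by (simp add: distrib_left)
qed

text \<open>Strictness comes from an initial piece \<open>{A..r}\<close> with \<open>r < s\<close>: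
  there the delayed arguments stay in \<open>{m..r}\<close>, where \<open>\<bar>x\<bar>\<close> has
  a maximum below \<open>\<bar>x s\<bar>\<close>.\<close>

lemma first_maximum_strict:
  assumes "t0 \<le> A" "A < s" "s \<le> B" "x A = 0" "x B = 0" and nz: "\<And>v. v \<in> {A<..<B} \<Longrightarrow> x v \<noteq> 0"
    and le: "\<And>v. v \<in> {m..B} \<Longrightarrow> \<bar>x v\<bar> \<le> \<bar>x s\<bar>" and less: "\<And>v. v \<in> {m..<s} \<Longrightarrow> \<bar>x v\<bar> < \<bar>x s\<bar>"
  shows "2 < V A B"
proof -
  define K where "K = \<bar>x s\<bar>"
  define r where "r = (A + s) / 2"
  have r: "A < r" "r < s"
    using assms by (auto simp: r_def)
  have "continuous_on {m..r} (\<lambda>v. \<bar>x v\<bar>)"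
    by (intro continuous_intros continuous) auto
  then obtain w where w: "w \<in> {m..r}" "\<And>v. v \<in> {m..r} \<Longrightarrow> \<bar>x v\<bar> \<le> \<bar>x w\<bar>"
    using continuous_attains_sup[of "{m..r}" "\<lambda>v. \<bar>x v\<bar>"] r assms m_le_t0 by auto
  have wK: "\<bar>x w\<bar> < K"
    using w(1) r less[of w] by (auto simp: K_def)
  have delay: "\<tau> v \<in> {m..v}" if "A \<le> v" for v
    using delay_ge[of v] delay_le[of v] that assms by auto
  have K: "\<bar>x (\<tau> v)\<bar> \<le> K" if "v \<in> {A..B}" for v
    unfolding K_def using delay[of v] that by (intro le) auto
  have "x r \<noteq> 0"
    using r assms by (intro nz) auto
  have "\<bar>x r - x A\<bar> \<le> \<bar>x w\<bar> * V A r"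
    using r assms delay by (intro increment_le w(2)) force+
  then have Ar: "\<bar>x r\<bar> \<le> \<bar>x w\<bar> * V A r"
    using assms by simp
  \<comment> \<open>The gain is strict only if \<open>V A r\<close> is positive; otherwise
    \<open>x r\<close> would be 0 although \<open>r\<close> lies inside the nodal interval.\<close>
  then have "V A r \<noteq> 0"
    using \<open>x r \<noteq> 0\<close> by auto
  then have "V A r > 0"
    using V_nonneg[of A r] by simp
  then have "\<bar>x r\<bar> < K * V A r"
    using Ar mult_strict_right_mono[OF wK, of "V A r"] by linarith
  moreover have "\<bar>x s - x r\<bar> \<le> K * V r s" "\<bar>x B - x s\<bar> \<le> K * V s B"
    using r assms(1-3) by (intro increment_le K; simp)+
  \<comment> \<open>\<open>K\<close> is at most
    \<open>\<bar>x r\<bar> + \<bar>x s - x r\<bar>\<close> and equals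
    \<open>\<bar>x B - x s\<bar>\<close>; the bounds of these three terms are added, the first being
    strict.\<close>
  ultimately have "2 * K < K * (V A r + V r s + V s B)"
    using \<open>x B = 0\<close> unfolding K_def distrib_left by linarith
  also have "V A r + V r s + V s B = V A B"
    using r assms V_combine[of A r s] V_combine[of A s B] by simp
  finally show ?thesis
    using wK mult_less_cancel_left_pos[of K 2 "V A B"] by (simp add: mult.commute)
qed

end

section \<open>Rapidly oscillating solutions: boundedness and decay\<close>

locale rapidly_oscillating_solution = dde_solution_on +
  fixes l :: real
  assumes osc: "rapidly_oscillating c l t0 x"
begin

lemma large_zero: obtains t where "t \<ge> T" "t \<ge> t0" "x t = 0"
  using osc unfolding rapidly_oscillating_def by blast

text \<open>Packages the oscillation condition for both main estimates: zeros \<open>T\<close> and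
  \<open>Z\<close> can be placed around any late point, and its nodal interval then falls under the
  bound \<open>l\<close>.\<close>

lemma eventually_nodal_interval:
  obtains t1 where "t1 \<ge> t0"
    "\<And>T Z s. t1 \<le> T \<Longrightarrow> x T = 0 \<Longrightarrow> x Z = 0 \<Longrightarrow> T \<le> s \<Longrightarrow> s \<le> Z \<Longrightarrow> x s \<noteq> 0 \<Longrightarrow>
      \<exists>A B. T \<le> A \<and> A < s \<and> s < B \<and> B \<le> Z \<and> x A = 0 \<and> x B = 0 \<and> (\<forall>v\<in>{A<..<B}. x v \<noteq> 0) \<and> V A B \<le> l"
proof -
  obtain t1 where t1: "t1 \<ge> t0"
    and l: "\<And>A B. A \<ge> t1 \<Longrightarrow> B \<ge> t1 \<Longrightarrow> A < B \<Longrightarrow> (\<forall>v\<in>{A<..<B}. x v \<noteq> 0) \<Longrightarrow> (LINT v:{A..B}|lebesgue. \<bar>c v\<bar>) \<le> l"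
    using osc unfolding rapidly_oscillating_def by meson
  show thesis
  proof (rule that[OF t1])
    fix T Z s
    assume T: "t1 \<le> T" and *: "x T = 0" "x Z = 0" "T \<le> s" "s \<le> Z" "x s \<noteq> 0"
    have "continuous_on {T..Z} x"
      using T t1 m_le_t0 by (intro continuous) auto
    from nodal_interval[OF this *] obtain A B where AB: "T \<le> A" "A < s" "s < B" "B \<le> Z" "x A = 0" "x B = 0"
      "\<forall>v\<in>{A<..<B}. x v \<noteq> 0"
      by metis
    moreover have "V A B \<le> l"
      using l[of A B] V_eq[of A B] AB T t1 by simp
    ultimately show "\<exists>A B. T \<le> A \<and> A < s \<and> s < B \<and> B \<le> Z \<and> x A = 0 \<and> x B = 0 \<and> (\<forall>v\<in>{A<..<B}. x v \<noteq> 0) \<and> V A B \<le> l"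
      by blast
  qed
qed

text \<open>The bound is the maximum of \<open>\<bar>x\<bar>\<close> on \<open>{m..T}\<close> for a
  late zero \<open>T\<close>. A larger value would put the first maximum on some
  \<open>{m..Z}\<close> inside a nodal interval beyond \<open>T\<close>, where
  \<open>2 < V A B \<le> l\<close>.\<close>

lemma solution_bounded:
  assumes "l \<le> 2"
  shows "\<exists>M. \<forall>s\<ge>m. \<bar>x s\<bar> \<le> M"
proof -
  obtain t1 where t1: "t1 \<ge> t0" and nodal:
    "\<And>T Z s. t1 \<le> T \<Longrightarrow> x T = 0 \<Longrightarrow> x Z = 0 \<Longrightarrow> T \<le> s \<Longrightarrow> s \<le> Z \<Longrightarrow> x s \<noteq> 0 \<Longrightarrow>
      \<exists>A B. T \<le> A \<and> A < s \<and> s < B \<and> B \<le> Z \<and> x A = 0 \<and> x B = 0 \<and> (\<forall>v\<in>{A<..<B}. x v \<noteq> 0) \<and> V A B \<le> l"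
    by (rule eventually_nodal_interval) blast
  obtain T where T: "T \<ge> t1" "x T = 0"
    by (rule large_zero)
  have cont: "continuous_on {m..q} (\<lambda>v. \<bar>x v\<bar>)" for q
    by (intro continuous_intros continuous) auto
  obtain w where w: "w \<in> {m..T}" "\<And>v. v \<in> {m..T} \<Longrightarrow> \<bar>x v\<bar> \<le> \<bar>x w\<bar>"
    using continuous_attains_sup[OF _ _ cont[of T]] T t1 m_le_t0 by auto
  have "\<bar>x s\<bar> \<le> \<bar>x w\<bar>" if ms: "m \<le> s" for s
  proof (rule ccontr)
    assume "\<not> \<bar>x s\<bar> \<le> \<bar>x w\<bar>"
    then have s: "\<bar>x w\<bar> < \<bar>x s\<bar>"
      by simp
    \<comment> \<open>This zero makes the search for a maximum compact and closes the nodal interval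
      on the right.\<close>
    obtain Z where Z: "Z \<ge> s" "x Z = 0"
      by (rule large_zero)
    obtain u where u: "u \<in> {m..Z}" "\<And>v. v \<in> {m..Z} \<Longrightarrow> \<bar>x v\<bar> \<le> \<bar>x u\<bar>"
      using continuous_attains_sup[OF _ _ cont[of Z]] Z ms by auto
    \<comment> \<open>The maximum points of \<open>\<bar>x\<bar>\<close> on \<open>{m..Z}\<close>;
      the set is closed, so it has a least element, named \<open>q\<close> below.\<close>
    define S where "S = {m..Z} \<inter> (\<lambda>v. \<bar>x v\<bar>) -` {\<bar>x u\<bar>..}"
    have "closed S"
      unfolding S_def by (intro continuous_closed_preimage cont) auto
    moreover have S: "u \<in> S" "bdd_below S"
      using u by (auto simp: S_def bdd_below_def)
    ultimately have IS: "Inf S \<in> S"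
      by (auto intro: closed_contains_Inf)
    define q where "q = Inf S"
    have q: "q \<in> {m..Z}" "\<bar>x q\<bar> = \<bar>x u\<bar>"
      using IS u(2) by (auto simp: S_def q_def intro: antisym)
    have q_first: "\<bar>x v\<bar> < \<bar>x q\<bar>" if v: "v \<in> {m..<q}" for v
    proof (rule ccontr)
      assume "\<not> \<bar>x v\<bar> < \<bar>x q\<bar>"
      then have "v \<in> S"
        using v q by (auto simp: S_def)
      then show False
        using cInf_lower[OF _ S(2), of v] v by (auto simp: q_def)
    qed
    have xq: "\<bar>x w\<bar> < \<bar>x q\<bar>"
      using s u(2)[of s] ms Z q by auto
    then have "T < q"
      using w(2)[of q] q(1) by force
    moreover have "x q \<noteq> 0"
      using xq by auto
    ultimately obtain A B where AB: "T \<le> A" "A < q" "q < B" "B \<le> Z" "x A = 0" "x B = 0"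
      "\<forall>v\<in>{A<..<B}. x v \<noteq> 0" "V A B \<le> l"
      using nodal[of T Z q] T Z q by auto
    have "2 < V A B"
      using AB T t1 u(2) q q_first by (intro first_maximum_strict[where s = q]) auto
    then show False
      using AB assms by simp
  qed
  then show ?thesis
    by blast
qed

text \<open>Each pass improves an eventual bound \<open>K\<close> of \<open>\<bar>x\<bar>\<close> to
  \<open>l / 2 * K\<close>; boundedness starts the iteration, and the factor is below 1.\<close>

lemma solution_tendsto_0:
  assumes "0 \<le> l" "l < 2"
  shows "(x \<longlongrightarrow> 0) at_top"
proof -
  obtain M where M: "\<And>s. m \<le> s \<Longrightarrow> \<bar>x s\<bar> \<le> M"
    using solution_bounded[OF less_imp_le[OF \<open>l < 2\<close>]] by blast
  obtain t1 where t1: "t1 \<ge> t0" and nodal: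
    "\<And>T Z s. t1 \<le> T \<Longrightarrow> x T = 0 \<Longrightarrow> x Z = 0 \<Longrightarrow> T \<le> s \<Longrightarrow> s \<le> Z \<Longrightarrow> x s \<noteq> 0 \<Longrightarrow>
      \<exists>A B. T \<le> A \<and> A < s \<and> s < B \<and> B \<le> Z \<and> x A = 0 \<and> x B = 0 \<and> (\<forall>v\<in>{A<..<B}. x v \<noteq> 0) \<and> V A B \<le> l"
    by (rule eventually_nodal_interval) blast
  have M_nonneg: "0 \<le> M"
    using M[of m] by linarith
  have decay: "eventually (\<lambda>s. \<bar>x s\<bar> \<le> (l / 2) ^ n * M) at_top" for n
  proof (induction n)
    case 0
    then show ?case
      using M by (auto intro: eventually_at_top_linorderI[of m])
  next
    case (Suc n)
    define K where "K = (l / 2) ^ n * M"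
    have "K \<ge> 0"
      using assms M_nonneg by (simp add: K_def)
    have "filterlim \<tau> at_top at_top"
      using data by (simp add: dde_data_def)
    \<comment> \<open>As \<open>\<tau>\<close> tends to infinity, an eventual bound of
      \<open>\<bar>x\<bar>\<close> passes to the delayed values.\<close>
    then have "eventually (\<lambda>v. \<bar>x (\<tau> v)\<bar> \<le> K) at_top"
      using Suc unfolding K_def filterlim_iff by blast
    then obtain T0 where T0: "\<And>v. v \<ge> T0 \<Longrightarrow> \<bar>x (\<tau> v)\<bar> \<le> K"
      by (auto simp: eventually_at_top_linorder)
    \<comment> \<open>Starting at a zero keeps the nodal interval of every later nonzero point in
      \<open>{T..}\<close>, where both the bound \<open>K\<close> and the oscillation condition
      hold.\<close>
    obtain T where T: "T \<ge> max T0 t1" "x T = 0"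
      by (rule large_zero)
    have "\<bar>x s\<bar> \<le> l / 2 * K" if Ts: "s \<ge> T" for s
    proof (cases "x s = 0")
      case True
      then show ?thesis
        using assms \<open>K \<ge> 0\<close> by simp
    next
      case False
      obtain Z where "Z \<ge> s" "x Z = 0"
        by (rule large_zero)
      then obtain A B where AB: "T \<le> A" "A < s" "s < B" "x A = 0" "x B = 0" "V A B \<le> l"
        using nodal[of T Z s] T Ts False by auto
      have "2 * \<bar>x s\<bar> \<le> K * V A B"
        using AB T t1 by (intro nodal_bound T0) auto
      also have "\<dots> \<le> K * l"
        using AB \<open>K \<ge> 0\<close> by (intro mult_left_mono)
      finally show ?thesis
        by (simp add: mult.commute)
    qed
    then show ?case
      by (auto intro!: eventually_at_top_linorderI[of T] simp: K_def mult.assoc)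
  qed
  show ?thesis
  proof (rule tendstoI)
    fix e :: real
    assume "e > 0"
    have "(\<lambda>n. (l / 2) ^ n * M) \<longlonglongrightarrow> 0"
      using assms by (intro tendsto_mult_left_zero LIMSEQ_realpow_zero) auto
    then have "eventually (\<lambda>n. (l / 2) ^ n * M < e) sequentially"
      using \<open>e > 0\<close> by (rule order_tendstoD(2))
    then obtain n where "(l / 2) ^ n * M < e"
      using eventually_happens sequentially_bot by blast
    then show "eventually (\<lambda>s. dist (x s) 0 < e) at_top"
      using decay[of n] by (auto elim!: eventually_mono)
  qed
qed

end

section \<open>Initial points beyond \<open>\<rho>\<close> and the conclusion\<close>

lemma tau_min_mono: "s \<le> t \<Longrightarrow> tau_min \<tau> s \<le> tau_min \<tau> t"
  unfolding tau_min_def by (intro INF_superset_mono) auto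

theorem theorem3p3:
  fixes c \<tau> :: "real \<Rightarrow> real" and a \<rho> l :: real
  assumes "dde_data c \<tau>"
    and "a \<ge> 0" and "tau_min \<tau> a > 0"
    and "\<rho> > Inf {t. t > 0 \<and> tau_min \<tau> t > ereal a}"
  shows "(l \<in> {0..2} \<longrightarrow>
            (\<forall>t0\<ge>\<rho>. \<forall>x. dde_solution c \<tau> t0 x \<and> rapidly_oscillating c l t0 x
               \<longrightarrow> bounded (x ` sol_domain \<tau> t0))) \<and>
         (l \<in> {0..<2} \<longrightarrow>
            (\<forall>t0\<ge>\<rho>. \<forall>x. dde_solution c \<tau> t0 x \<and> rapidly_oscillating c l t0 x
               \<longrightarrow> (x \<longlongrightarrow> 0) at_top))"
proof -
  define I where "I = {t. t > 0 \<and> tau_min \<tau> t > ereal a}"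
  have "filterlim \<tau> at_top at_top"
    using assms(1) by (simp add: dde_data_def)
  then have "eventually (\<lambda>v. \<tau> v \<ge> a + 1) at_top"
    by (simp add: filterlim_at_top)
  then obtain b where b: "\<And>v. v \<ge> b \<Longrightarrow> \<tau> v \<ge> a + 1"
    by (auto simp: eventually_at_top_linorder)
  \<comment> \<open>The value \<open>a + 1\<close> leaves room for the strict inequality, and
    \<open>max b 1\<close> is positive; membership in \<open>I\<close> demands both.\<close>
  have "ereal (a + 1) \<le> tau_min \<tau> (max b 1)"
    unfolding tau_min_def using b by (intro INF_greatest) auto
  moreover have "ereal a < ereal (a + 1)"
    by simp
  ultimately have "ereal a < tau_min \<tau> (max b 1)"
    by (rule less_le_trans[rotated])
  then have "max b 1 \<in> I"
    by (simp add: I_def)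
  then obtain i where i: "i \<in> I" "i < \<rho>"
    using assms(4) cInf_lessD[of I \<rho>] by (auto simp: I_def)
  have sol: "\<exists>m. rapidly_oscillating_solution c \<tau> x t0 m l \<and> sol_domain \<tau> t0 = {m..}"
    if x: "dde_solution c \<tau> t0 x" "rapidly_oscillating c l t0 x" and t0: "t0 \<ge> \<rho>" for x t0
  proof -
    have "t0 \<ge> 0"
      using i t0 by (auto simp: I_def)
    \<comment> \<open>Monotonicity from \<open>i\<close> to \<open>t0\<close> gives a lower bound,
      and \<open>\<tau> t0\<close> is an upper one, so \<open>tau_min \<tau> t0\<close> is a real
      number as the locale demands.\<close>
    have "ereal a < tau_min \<tau> t0"
      using i t0 tau_min_mono[of i t0 \<tau>] by (auto simp: I_def)
    moreover have "tau_min \<tau> t0 \<le> ereal (\<tau> t0)"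
      unfolding tau_min_def by (intro INF_lower) auto
    ultimately obtain m where "tau_min \<tau> t0 = ereal m"
      by (cases "tau_min \<tau> t0") auto
    then interpret rapidly_oscillating_solution c \<tau> x t0 m l
      using assms(1) x \<open>t0 \<ge> 0\<close> by unfold_locales
    show ?thesis
      using rapidly_oscillating_solution_axioms domain_eq by blast
  qed
  show ?thesis
  proof (intro conjI impI allI)
    fix t0 x
    assume l: "l \<in> {0..2}" and t0: "\<rho> \<le> t0" and x: "dde_solution c \<tau> t0 x \<and> rapidly_oscillating c l t0 x"
    then obtain m where m: "rapidly_oscillating_solution c \<tau> x t0 m l" "sol_domain \<tau> t0 = {m..}"
      using sol by blast
    have "l \<le> 2"
      using l by simp
    then obtain M where "\<forall>s\<ge>m. \<bar>x s\<bar> \<le> M"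
      using rapidly_oscillating_solution.solution_bounded[OF m(1)] by blast
    then show "bounded (x ` sol_domain \<tau> t0)"
      unfolding m(2) bounded_iff by auto
  next
    fix t0 x
    assume l: "l \<in> {0..<2}" and t0: "\<rho> \<le> t0" and x: "dde_solution c \<tau> t0 x \<and> rapidly_oscillating c l t0 x"
    then obtain m where "rapidly_oscillating_solution c \<tau> x t0 m l"
      using sol by blast
    then show "(x \<longlongrightarrow> 0) at_top"
      using rapidly_oscillating_solution.solution_tendsto_0 l by auto
  qed
qed

end
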